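(* Let $G$ be a three-dimensional unimodular Lie group with a left-invariant Lorentzian metric whose metric Lie algebra is of type $\mathcal{A}_2$ (with parameters $\lambda_1,\lambda_2\in\mathbb{R}$) or of type $\mathcal{A}_3$ (with parameter $\lambda\in\mathbb{R}$). Then $\mathrm{div}_1(SW)=0$. If moreover $\mathrm{curl}(SW)=0$ (i.e. the Schouten--Weyl tensor is almost harmonic), then the Schouten--Weyl tensor is trivial, $SW=0$ (so $\mathrm{div}_2(SW)=0$), and one of the following holds: (1) the metric Lie algebra is of type $\mathcal{A}_2$ with $\lambda_1=\lambda_2=0$, and the Lie algebra of $G$ is isomorphic to $h$; (2) the metric Lie algebra is of type $\mathcal{A}_3$ with $\lambda=0$, and the Lie algebra of $G$ is isomorphic to $e(1,1)$.
   Context: A left-invariant Lorentzian metric $\langle\cdot,\cdot\rangle$ on a Lie group $G$ is identified with an inner product of Lorentzian signature on its Lie algebra $\mathfrak{g}$. The metric Lie algebra is of type $\mathcal{A}_2$ or $\mathcal{A}_3$ if there is a pseudo-orthonormal basis $\{e_1,e_2,e_3\}$ of $\mathfrak{g}$, with $e_3$ timelike (so $\langle e_1,e_1\rangle=\langle e_2,e_2\rangle=1$, $\langle e_3,e_3\rangle=-1$, other products zero), such that, respectively: $\mathcal{A}_2$: $[e_1,e_2]=(1-\lambda_2)e_3-e_2$, $[e_1,e_3]=e_3-(1+\lambda_2)e_2$, $[e_2,e_3]=\lambda_1e_1$; $\mathcal{A}_3$: $[e_1,e_2]=e_1-\lambda e_3$, $[e_1,e_3]=-\lambda e_2-e_1$,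 $[e_2,e_3]=\lambda e_1+e_2+e_3$. Here $h$ is the three-dimensional Heisenberg Lie algebra and $e(1,1)$ is the Lie algebra of the group of rigid motions of the Minkowski plane. Let $\nabla$ be the Levi-Civita connection, $R(X,Y)Z=[\nabla_Y,\nabla_X]Z+\nabla_{[X,Y]}Z$ the curvature tensor, $r(X,Y)=\mathrm{tr}(Z\mapsto R(X,Z)Y)$ the Ricci tensor, $\rho$ the scalar curvature, and $g_{ij}$ the components of the metric. With $n=\dim G=3$, the one-dimensional curvature tensor $A$ and the Schouten--Weyl tensor $SW$ are $$A_{ik}=\frac{1}{n-2}\left(r_{ik}-\frac{\rho g_{ik}}{2(n-1)}\right),\qquad SW_{ijk}=A_{ij,k}-A_{ik,j},$$ where an index after a comma denotes covariant differentiation in the direction of that index. The divergences of types I and II are $\mathrm{div}_1(SW)=g^{it}SW_{ijk,t}$ and $\mathrm{div}_2(SW)=g^{jt}SW_{ijk,t}$. The condition $\mathrm{curl}(SW)=0$ means $SW_{ijk,t}=SW_{tjk,i}+SW_{itk,j}+SW_{ijt,k}$ for all indices $i,j,k,t$. A tensor $T_{i_1\ldots i_p}$ is called almost harmonic if $\mathrm{curl}(T)=0$ and $\mathrm{div}(T)=g^{i_1t}T_{i_1\ldots i_p,t}=0$. *)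

theory Defs
  imports "HOL-Analysis.Analysis"
begin

text \<open>
  A left-invariant Lorentzian metric on a Lie group is identified with a Lorentzian inner product
  on the Lie algebra \<open>'g\<close>, and left-invariant tensor fields with multilinear maps on \<open>'g\<close>.
  Differential operators are those of the group restricted to left-invariant fields: functions
  obtained by evaluating left-invariant tensors on left-invariant fields are constant, so their
  derivatives drop out of the formulas below.
\<close>

section \<open>Metric Lie algebras\<close>

locale lie_algebra =
  fixes bracket :: "'g::real_vector \<Rightarrow> 'g \<Rightarrow> 'g"
  assumes bilinear_bracket: "bilinear bracket"
    and alternating: "bracket x x = 0"
    and jacobi: "bracket x (bracket y z) + bracket y (bracket z x) + bracket z (bracket x y) = 0"

definition pseudo_orthonormal_basis ::
    "('g::real_vector \<Rightarrow> 'g \<Rightarrow> real) \<Rightarrow> 'g \<Rightarrow> 'g \<Rightarrow> 'g \<Rightarrow> bool" where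
  "pseudo_orthonormal_basis ip e1 e2 e3 \<longleftrightarrow>
     independent {e1, e2, e3} \<and> span {e1, e2, e3} = UNIV \<and>
     ip e1 e1 = 1 \<and> ip e2 e2 = 1 \<and> ip e3 e3 = -1 \<and>
     ip e1 e2 = 0 \<and> ip e1 e3 = 0 \<and> ip e2 e3 = 0"

text \<open>Signature \<open>(+,+,-)\<close>; in particular \<open>'g\<close> is three-dimensional.\<close>
definition lorentzian_inner_product :: "('g::real_vector \<Rightarrow> 'g \<Rightarrow> real) \<Rightarrow> bool" where
  "lorentzian_inner_product ip \<longleftrightarrow>
     bilinear ip \<and> (\<forall>x y. ip x y = ip y x) \<and>
     (\<exists>e1 e2 e3. pseudo_orthonormal_basis ip e1 e2 e3)"

definition type_A2 ::
    "('g::real_vector \<Rightarrow> 'g \<Rightarrow> 'g) \<Rightarrow> ('g \<Rightarrow> 'g \<Rightarrow> real) \<Rightarrow> real \<Rightarrow> real \<Rightarrow> bool" where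
  "type_A2 br ip l1 l2 \<longleftrightarrow> (\<exists>e1 e2 e3. pseudo_orthonormal_basis ip e1 e2 e3 \<and>
     br e1 e2 = (1 - l2) *\<^sub>R e3 - e2 \<and>
     br e1 e3 = e3 - (1 + l2) *\<^sub>R e2 \<and>
     br e2 e3 = l1 *\<^sub>R e1)"

definition type_A3 ::
    "('g::real_vector \<Rightarrow> 'g \<Rightarrow> 'g) \<Rightarrow> ('g \<Rightarrow> 'g \<Rightarrow> real) \<Rightarrow> real \<Rightarrow> bool" where
  "type_A3 br ip l \<longleftrightarrow> (\<exists>e1 e2 e3. pseudo_orthonormal_basis ip e1 e2 e3 \<and>
     br e1 e2 = e1 - l *\<^sub>R e3 \<and>
     br e1 e3 = - (l *\<^sub>R e2) - e1 \<and>
     br e2 e3 = l *\<^sub>R e1 + e2 + e3)"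

section \<open>Traces\<close>

text \<open>For linear \<open>f\<close> on a finite-dimensional space the value does not depend on the basis chosen.\<close>
definition lin_trace :: "('g::real_vector \<Rightarrow> 'g) \<Rightarrow> real" where
  "lin_trace f = (let B = (SOME B. independent B \<and> span B = UNIV)
                  in \<Sum>b\<in>B. representation B (f b) b)"

text \<open>The contraction \<open>g\<^sup>i\<^sup>t T\<^sub>i\<^sub>t\<close>: the trace of \<open>T\<close> after raising its second index.\<close>
definition metric_trace ::
    "('g::real_vector \<Rightarrow> 'g \<Rightarrow> real) \<Rightarrow> ('g \<Rightarrow> 'g \<Rightarrow> real) \<Rightarrow> real" where
  "metric_trace ip T = lin_trace (\<lambda>x. THE v. \<forall>y. ip v y = T x y)"

text \<open>Unimodularity of a (connected) Lie group, expressed on its Lie algebra: \<open>tr (ad x) = 0\<close>.\<close>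
definition unimodular :: "('g::real_vector \<Rightarrow> 'g \<Rightarrow> 'g) \<Rightarrow> bool" where
  "unimodular br \<longleftrightarrow> (\<forall>x. lin_trace (br x) = 0)"

section \<open>Connection and curvature\<close>

definition levi_civita ::
    "('g::real_vector \<Rightarrow> 'g \<Rightarrow> 'g) \<Rightarrow> ('g \<Rightarrow> 'g \<Rightarrow> real) \<Rightarrow> 'g \<Rightarrow> 'g \<Rightarrow> 'g" where
  "levi_civita br ip = (THE D. bilinear D \<and>
     (\<forall>x y. D x y - D y x = br x y) \<and>
     (\<forall>x y z. ip (D x y) z + ip y (D x z) = 0))"

definition curvature ::
    "('g::real_vector \<Rightarrow> 'g \<Rightarrow> 'g) \<Rightarrow> ('g \<Rightarrow> 'g \<Rightarrow> real) \<Rightarrow> 'g \<Rightarrow> 'g \<Rightarrow> 'g \<Rightarrow> 'g" where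
  "curvature br ip x y z = (let D = levi_civita br ip in
     D y (D x z) - D x (D y z) + D (br x y) z)"

definition ricci ::
    "('g::real_vector \<Rightarrow> 'g \<Rightarrow> 'g) \<Rightarrow> ('g \<Rightarrow> 'g \<Rightarrow> real) \<Rightarrow> 'g \<Rightarrow> 'g \<Rightarrow> real" where
  "ricci br ip x y = lin_trace (\<lambda>z. curvature br ip x z y)"

definition scalar_curvature ::
    "('g::real_vector \<Rightarrow> 'g \<Rightarrow> 'g) \<Rightarrow> ('g \<Rightarrow> 'g \<Rightarrow> real) \<Rightarrow> real" where
  "scalar_curvature br ip = metric_trace ip (ricci br ip)"

definition one_dim_curvature ::
    "('g::real_vector \<Rightarrow> 'g \<Rightarrow> 'g) \<Rightarrow> ('g \<Rightarrow> 'g \<Rightarrow> real) \<Rightarrow> 'g \<Rightarrow> 'g \<Rightarrow> real" where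
  "one_dim_curvature br ip x y = (let n = real (dim (UNIV :: 'g set)) in
     1 / (n - 2) * (ricci br ip x y - scalar_curvature br ip * ip x y / (2 * (n - 1))))"

text \<open>
  Covariant derivatives of left-invariant tensors of rank 2 and 3. The direction of differentiation
  is the last argument: \<open>cov_deriv2 br ip T e\<^sub>i e\<^sub>j e\<^sub>k\<close> is \<open>T\<^sub>i\<^sub>j\<^sub>,\<^sub>k\<close>.
\<close>
definition cov_deriv2 ::
    "('g::real_vector \<Rightarrow> 'g \<Rightarrow> 'g) \<Rightarrow> ('g \<Rightarrow> 'g \<Rightarrow> real) \<Rightarrow>
     ('g \<Rightarrow> 'g \<Rightarrow> real) \<Rightarrow> 'g \<Rightarrow> 'g \<Rightarrow> 'g \<Rightarrow> real" where
  "cov_deriv2 br ip T x y w = (let D = levi_civita br ip in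
     - T (D w x) y - T x (D w y))"

definition cov_deriv3 ::
    "('g::real_vector \<Rightarrow> 'g \<Rightarrow> 'g) \<Rightarrow> ('g \<Rightarrow> 'g \<Rightarrow> real) \<Rightarrow>
     ('g \<Rightarrow> 'g \<Rightarrow> 'g \<Rightarrow> real) \<Rightarrow> 'g \<Rightarrow> 'g \<Rightarrow> 'g \<Rightarrow> 'g \<Rightarrow> real" where
  "cov_deriv3 br ip T x y z w = (let D = levi_civita br ip in
     - T (D w x) y z - T x (D w y) z - T x y (D w z))"

definition schouten_weyl ::
    "('g::real_vector \<Rightarrow> 'g \<Rightarrow> 'g) \<Rightarrow> ('g \<Rightarrow> 'g \<Rightarrow> real) \<Rightarrow> 'g \<Rightarrow> 'g \<Rightarrow> 'g \<Rightarrow> real" where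
  "schouten_weyl br ip x y z = (let A = one_dim_curvature br ip in
     cov_deriv2 br ip A x y z - cov_deriv2 br ip A x z y)"

section \<open>Divergences, curl, almost harmonic tensors\<close>

definition div1 ::
    "('g::real_vector \<Rightarrow> 'g \<Rightarrow> 'g) \<Rightarrow> ('g \<Rightarrow> 'g \<Rightarrow> real) \<Rightarrow>
     ('g \<Rightarrow> 'g \<Rightarrow> 'g \<Rightarrow> real) \<Rightarrow> 'g \<Rightarrow> 'g \<Rightarrow> real" where
  "div1 br ip T y z = metric_trace ip (\<lambda>x t. cov_deriv3 br ip T x y z t)"

definition div2 ::
    "('g::real_vector \<Rightarrow> 'g \<Rightarrow> 'g) \<Rightarrow> ('g \<Rightarrow> 'g \<Rightarrow> real) \<Rightarrow>
     ('g \<Rightarrow> 'g \<Rightarrow> 'g \<Rightarrow> real) \<Rightarrow> 'g \<Rightarrow> 'g \<Rightarrow> real" where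
  "div2 br ip T x z = metric_trace ip (\<lambda>y t. cov_deriv3 br ip T x y z t)"

definition curl_free ::
    "('g::real_vector \<Rightarrow> 'g \<Rightarrow> 'g) \<Rightarrow> ('g \<Rightarrow> 'g \<Rightarrow> real) \<Rightarrow>
     ('g \<Rightarrow> 'g \<Rightarrow> 'g \<Rightarrow> real) \<Rightarrow> bool" where
  "curl_free br ip T \<longleftrightarrow> (\<forall>x y z w.
     cov_deriv3 br ip T x y z w =
     cov_deriv3 br ip T w y z x + cov_deriv3 br ip T x w z y + cov_deriv3 br ip T x y w z)"

definition almost_harmonic ::
    "('g::real_vector \<Rightarrow> 'g \<Rightarrow> 'g) \<Rightarrow> ('g \<Rightarrow> 'g \<Rightarrow> real) \<Rightarrow>
     ('g \<Rightarrow> 'g \<Rightarrow> 'g \<Rightarrow> real) \<Rightarrow> bool" where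
  "almost_harmonic br ip T \<longleftrightarrow> curl_free br ip T \<and> (\<forall>y z. div1 br ip T y z = 0)"

section \<open>The Lie algebras h and e(1,1)\<close>

text \<open>Isomorphism onto a linear Lie algebra of \<open>3 \<times> 3\<close> matrices under the commutator.\<close>
definition isomorphic_to_matrix_algebra ::
    "('g::real_vector \<Rightarrow> 'g \<Rightarrow> 'g) \<Rightarrow> (real^3^3) set \<Rightarrow> bool" where
  "isomorphic_to_matrix_algebra br S \<longleftrightarrow> (\<exists>\<phi>. linear \<phi> \<and> bij_betw \<phi> UNIV S \<and>
     (\<forall>x y. \<phi> (br x y) = \<phi> x ** \<phi> y - \<phi> y ** \<phi> x))"

text \<open>Strictly upper triangular matrices.\<close>
definition heisenberg :: "(real^3^3) set" where
  "heisenberg = {M. M$1$1 = 0 \<and> M$2$1 = 0 \<and> M$2$2 = 0 \<and> (\<forall>j. M$3$j = 0)}"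

text \<open>
  A rigid motion \<open>v \<mapsto> L v + b\<close> of the Minkowski plane is represented on the affine plane
  \<open>v$3 = 1\<close> by the matrix with blocks \<open>L\<close>, \<open>b\<close> and last row \<open>(0,0,1)\<close>. The Lie algebra of this
  matrix group consists of the matrices with last row zero whose action on the plane of directions
  \<open>v$3 = 0\<close> is skew with respect to the Minkowski product.
\<close>
definition minkowski :: "real^3 \<Rightarrow> real^3 \<Rightarrow> real" where
  "minkowski v w = v$1 * w$1 - v$2 * w$2"

definition e11 :: "(real^3^3) set" where
  "e11 = {M. (\<forall>j. M$3$j = 0) \<and>
     (\<forall>v w. v$3 = 0 \<longrightarrow> w$3 = 0 \<longrightarrow> minkowski (M *v v) w + minkowski v (M *v w) = 0)}"

end

theory Submission
  imports Defs
begin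

text \<open>
  Every tensor occurring here is multilinear, so it is determined by its values on the
  pseudo-orthonormal basis of the normal form. The Koszul formula gives the connection on that
  basis, and from it all components of the Ricci, Schouten-Weyl and differentiated Schouten-Weyl
  tensors are explicit polynomials in the structure constants. The components of \<open>div\<^sub>1(SW)\<close> cancel
  identically, while a few components of \<open>curl(SW)\<close> have no common real zero except the origin of
  the parameter space, where \<open>SW\<close> vanishes and the brackets are those of \<open>h\<close> and \<open>e(1,1)\<close>.
\<close>

section \<open>Basis independence of the trace\<close>

text \<open>Both sums equal one double sum over \<open>B\<close> and \<open>C\<close>: expanding
  \<open>b\<close> along \<open>C\<close> splits each diagonal entry for \<open>B\<close>, and after
  exchanging the sums the inner sum over \<open>b\<close> reassembles the diagonal entry for
  \<open>C\<close>.\<close>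

lemma sum_representation_basis_cong:
  fixes f :: "'g::real_vector \<Rightarrow> 'g"
  assumes f: "linear f"
    and B: "independent B" "span B = UNIV" "finite B"
    and C: "independent C" "span C = UNIV" "finite C"
  shows "(\<Sum>b\<in>B. representation B (f b) b) = (\<Sum>c\<in>C. representation C (f c) c)"
proof -
  \<comment> \<open>Change of coordinates, used once with \<open>g = f\<close> and once, read
    backwards, with \<open>g\<close> the identity.\<close>
  have expand: "representation E (g v) e = (\<Sum>d\<in>D. representation D v d * representation E (g d) e)"
    if E: "independent E" "span E = UNIV" and D: "independent D" "span D = UNIV" "finite D"
      and g: "linear g" for E D v e and g :: "'g \<Rightarrow> 'g"
  proof -
    have "g v = g (\<Sum>d\<in>D. representation D v d *\<^sub>R d)"
      using D by (simp add: real_vector.sum_representation_eq)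
    also have "\<dots> = (\<Sum>d\<in>D. representation D v d *\<^sub>R g d)"
      by (simp add: linear_sum[OF g] linear_scale[OF g])
    finally show ?thesis
      using E by (simp add: real_vector.representation_sum real_vector.representation_scale)
  qed
  have "(\<Sum>b\<in>B. representation B (f b) b)
      = (\<Sum>b\<in>B. \<Sum>c\<in>C. representation C b c * representation B (f c) b)"
    by (intro sum.cong refl expand B C f)
  also have "\<dots> = (\<Sum>c\<in>C. \<Sum>b\<in>B. representation B (f c) b * representation C b c)"
    by (subst sum.swap) (simp add: mult.commute)
  also have "\<dots> = (\<Sum>c\<in>C. representation C (f c) c)"
    by (intro sum.cong refl expand[OF C(1,2) B linear_ident, symmetric])
  finally show ?thesis .
qed

lemma lin_trace_basis:
  assumes "linear f" and B: "independent B" "span B = UNIV" "finite B"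
  shows "lin_trace f = (\<Sum>b\<in>B. representation B (f b) b)"
proof -
  define C :: "'a set" where "C = (SOME C. independent C \<and> span C = UNIV)"
  have C: "independent C" "span C = UNIV"
    using someI_ex[of "\<lambda>C :: 'a set. independent C \<and> span C = UNIV"] B
    unfolding C_def by blast+
  \<comment> \<open>\<open>lin_trace\<close> sums over a basis picked by \<open>SOME\<close>, and a
    sum over an infinite set would be 0 by convention. The finite spanning set \<open>B\<close>
    bounds every independent set.\<close>
  moreover have "finite C"
    using independent_span_bound[of B C] B C by auto
  ultimately show ?thesis
    using sum_representation_basis_cong[OF assms(1) B] by (simp add: lin_trace_def C_def Let_def)
qed

section \<open>Rules for multilinear maps, and matrix entries of e(1,1)\<close>

lemmas bilinear_simps =
  bilinear_ladd bilinear_radd bilinear_lmul bilinear_rmul bilinear_lneg bilinear_rneg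
  bilinear_lsub bilinear_rsub bilinear_lzero bilinear_rzero

lemmas linear_simps = linear_add linear_scale linear_neg linear_diff linear_0

lemma bilinearI':
  assumes "\<And>x. linear (f x)" "\<And>y. linear (\<lambda>x. f x y)"
  shows "bilinear f"
  using assms by (simp add: bilinear_def)

lemma bilinearD:
  assumes "bilinear f"
  shows "linear (f x)" "linear (\<lambda>x. f x y)"
  using assms by (simp_all add: bilinear_def)

text \<open>Skewness for the form diag(1,-1) is tested on the pairs (1,1), (2,2) and (1,2) of axis
  vectors; each pair isolates one condition on the upper left block.\<close>

lemma e11_eq: "e11 = {M. M$1$1 = 0 \<and> M$2$2 = 0 \<and> M$1$2 = M$2$1 \<and> (\<forall>j. M$3$j = 0)}"
proof (intro equalityI subsetI)
  fix M assume M: "M \<in> e11"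
  then have skew: "minkowski (M *v v) w + minkowski v (M *v w) = 0" if "v$3 = 0" "w$3 = 0" for v w
    using that by (simp add: e11_def)
  note skew_simps = minkowski_def matrix_vector_mult_def sum_3 axis_def
  have "M$1$1 = 0"
    using skew[of "axis 1 1" "axis 1 1"] by (simp add: skew_simps)
  moreover have "M$2$2 = 0"
    using skew[of "axis 2 1" "axis 2 1"] by (simp add: skew_simps)
  moreover have "M$1$2 = M$2$1"
    using skew[of "axis 1 1" "axis 2 1"] by (simp add: skew_simps)
  ultimately show "M \<in> {M. M$1$1 = 0 \<and> M$2$2 = 0 \<and> M$1$2 = M$2$1 \<and> (\<forall>j. M$3$j = 0)}"
    using M by (simp add: e11_def)
qed (auto simp: e11_def minkowski_def matrix_vector_mult_def sum_3 algebra_simps)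

section \<open>Expansions and contractions in a pseudo-orthonormal frame\<close>

locale pseudo_orthonormal_frame = lie_algebra bracket
  for bracket :: "'g::real_vector \<Rightarrow> 'g \<Rightarrow> 'g" +
  fixes ip :: "'g \<Rightarrow> 'g \<Rightarrow> real" and e1 e2 e3 :: 'g
  assumes bilinear_ip: "bilinear ip"
    and ip_commute: "ip x y = ip y x"
    and frame: "pseudo_orthonormal_basis ip e1 e2 e3"
begin

lemma ip_frame [simp]:
  "ip e1 e1 = 1" "ip e2 e2 = 1" "ip e3 e3 = -1"
  "ip e1 e2 = 0" "ip e1 e3 = 0" "ip e2 e3 = 0"
  "ip e2 e1 = 0" "ip e3 e1 = 0" "ip e3 e2 = 0"
  using frame ip_commute by (simp_all add: pseudo_orthonormal_basis_def)

lemma independent_frame: "independent {e1, e2, e3}"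
  and span_frame: "span {e1, e2, e3} = UNIV"
  using frame by (simp_all add: pseudo_orthonormal_basis_def)

lemma frame_distinct: "e1 \<noteq> e2" "e1 \<noteq> e3" "e2 \<noteq> e3"
  using ip_frame by (metis zero_neq_one)+

lemmas ip_simps = bilinear_simps[OF bilinear_ip]

text \<open>Both sides are linear in \<open>v\<close> and agree on the frame. The coordinate along
  \<open>e3\<close> is \<open>- ip v e3\<close> because \<open>ip e3 e3 = -1\<close>; this sign
  recurs in every contraction below.\<close>

lemma frame_expansion: "v = ip v e1 *\<^sub>R e1 + ip v e2 *\<^sub>R e2 - ip v e3 *\<^sub>R e3"
proof (rule linear_eq_on[where B = "{e1, e2, e3}" and f = "\<lambda>v. v"])
  show "linear (\<lambda>v. ip v e1 *\<^sub>R e1 + ip v e2 *\<^sub>R e2 - ip v e3 *\<^sub>R e3)"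
    by (rule linearI) (simp_all add: ip_simps algebra_simps)
qed (auto simp: span_frame linear_ident)

lemma linear_frame_expansion:
  "linear f \<Longrightarrow> f v = ip v e1 *\<^sub>R f e1 + ip v e2 *\<^sub>R f e2 - ip v e3 *\<^sub>R f e3"
  by (subst frame_expansion[of v]) (simp add: linear_simps)

lemma linear_zero_on_frame:
  "linear f \<Longrightarrow> f e1 = 0 \<Longrightarrow> f e2 = 0 \<Longrightarrow> f e3 = 0 \<Longrightarrow> f v = 0"
  by (subst linear_frame_expansion) simp_all

lemma frame_eqI:
  "ip v e1 = ip w e1 \<Longrightarrow> ip v e2 = ip w e2 \<Longrightarrow> ip v e3 = ip w e3 \<Longrightarrow> v = w"
  by (subst frame_expansion[of v], subst frame_expansion[of w]) simp

lemma bilinear_zero_on_frame: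
  assumes "\<And>y. linear (\<lambda>x. T x y)" "\<And>x. linear (T x)"
    and "\<And>x y. x \<in> {e1, e2, e3} \<Longrightarrow> y \<in> {e1, e2, e3} \<Longrightarrow> T x y = 0"
  shows "T x y = 0"
  by (intro linear_zero_on_frame[of "\<lambda>x. T x y" x] linear_zero_on_frame[of "T _" y] assms) simp_all

text \<open>Supplies the uniqueness behind both definite descriptions: the raised index in
  \<open>metric_trace\<close> and the connection in \<open>levi_civita\<close>.\<close>

lemma nondegenerate: "(\<And>z. ip v z = ip w z) \<Longrightarrow> v = w"
  by (intro frame_eqI)

lemma dim_frame: "dim (UNIV :: 'g set) = 3"
  using dim_eq_card[of "{e1, e2, e3}" UNIV] independent_frame span_frame frame_distinct
  by simp

lemma representation_frame:
  "representation {e1, e2, e3} v e1 = ip v e1"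
  "representation {e1, e2, e3} v e2 = ip v e2"
  "representation {e1, e2, e3} v e3 = - ip v e3"
proof -
  let ?r = "representation {e1, e2, e3} v"
  have "ip v z = ip (?r e1 *\<^sub>R e1 + ?r e2 *\<^sub>R e2 + ?r e3 *\<^sub>R e3) z" for z
    using real_vector.sum_representation_eq[of "{e1, e2, e3}" v "{e1, e2, e3}"]
      independent_frame span_frame frame_distinct by (simp add: add.assoc)
  from this[of e1] this[of e2] this[of e3]
  show "?r e1 = ip v e1" "?r e2 = ip v e2" "?r e3 = - ip v e3"
    by (simp_all add: ip_simps)
qed

lemma lin_trace_frame:
  "linear f \<Longrightarrow> lin_trace f = ip (f e1) e1 + ip (f e2) e2 - ip (f e3) e3"
  using lin_trace_basis[OF _ independent_frame span_frame] frame_distinct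
  by (simp add: representation_frame)

lemma metric_trace_frame:
  assumes T: "bilinear T"
  shows "metric_trace ip T = T e1 e1 + T e2 e2 - T e3 e3"
proof -
  \<comment> \<open>The vector metrically dual to the functional \<open>T x\<close>, that is,
    \<open>T\<close> with its second index raised.\<close>
  define raise where "raise x = T x e1 *\<^sub>R e1 + T x e2 *\<^sub>R e2 - T x e3 *\<^sub>R e3" for x
  have raise: "ip (raise x) y = T x y" for x y
    unfolding raise_def linear_frame_expansion[OF bilinearD(1)[OF T], of x y]
    by (simp add: ip_simps ip_commute[of y] algebra_simps)
  have "(THE v. \<forall>y. ip v y = T x y) = raise x" for x
    by (rule the_equality) (auto simp: raise intro: nondegenerate)
  moreover have "linear raise"
    unfolding raise_def by (rule linearI) (simp_all add: bilinear_simps[OF T] algebra_simps)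
  ultimately show ?thesis
    by (simp add: metric_trace_def lin_trace_frame raise)
qed

section \<open>The Levi-Civita connection from the Koszul formula\<close>

lemmas bracket_simps = bilinear_simps[OF bilinear_bracket]

lemma bracket_skew: "bracket y x = - bracket x y"
proof -
  have "bracket y x + bracket x y = 0"
    using alternating[of "y + x"] unfolding bracket_simps by (simp add: alternating add.commute)
  then show ?thesis
    by (simp add: eq_neg_iff_add_eq_0)
qed

text \<open>The coefficients are the 2 by 2 minors of the coordinates of \<open>x\<close> and
  \<open>y\<close>. The two minors that involve the third coordinate \<open>- ip _ e3\<close> change
  sign.\<close>

lemma bracket_frame_expansion:
  "bracket x y = (ip x e1 * ip y e2 - ip x e2 * ip y e1) *\<^sub>R bracket e1 e2
    - (ip x e1 * ip y e3 - ip x e3 * ip y e1) *\<^sub>R bracket e1 e3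
    - (ip x e2 * ip y e3 - ip x e3 * ip y e2) *\<^sub>R bracket e2 e3"
proof -
  have "bracket x y = bracket (ip x e1 *\<^sub>R e1 + ip x e2 *\<^sub>R e2 - ip x e3 *\<^sub>R e3)
      (ip y e1 *\<^sub>R e1 + ip y e2 *\<^sub>R e2 - ip y e3 *\<^sub>R e3)"
    using frame_expansion[of x] frame_expansion[of y] by argo
  then show ?thesis
    by (simp add: bracket_simps alternating bracket_skew[of e2 e1] bracket_skew[of e3 e1]
        bracket_skew[of e3 e2] algebra_simps)
qed

text \<open>The Koszul expression for the inner product of the covariant derivative of
  \<open>y\<close> along \<open>x\<close> with \<open>z\<close>. The terms differentiating inner
  products are absent, since these are constant on left-invariant fields.\<close>

definition koszul :: "'g \<Rightarrow> 'g \<Rightarrow> 'g \<Rightarrow> real" where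
  "koszul x y z = (ip (bracket x y) z - ip (bracket y z) x + ip (bracket z x) y) / 2"

definition D :: "'g \<Rightarrow> 'g \<Rightarrow> 'g" where
  "D x y = koszul x y e1 *\<^sub>R e1 + koszul x y e2 *\<^sub>R e2 - koszul x y e3 *\<^sub>R e3"

lemma linear_koszul:
  "linear (koszul x y)" "linear (\<lambda>y. koszul x y z)" "linear (\<lambda>x. koszul x y z)"
  unfolding koszul_def
  by (rule linearI; simp add: ip_simps bracket_simps algebra_simps add_divide_distrib diff_divide_distrib)+

lemma ip_D: "ip (D x y) z = koszul x y z"
  unfolding D_def linear_frame_expansion[OF linear_koszul(1), of x y z]
  by (simp add: ip_simps ip_commute[of z] algebra_simps)

lemma bilinear_D: "bilinear D"
  unfolding D_def
  by (intro bilinearI' linearI; simp add: linear_koszul[THEN linear_add] linear_koszul[THEN linear_scale] algebra_simps)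

lemma levi_civita_eq: "levi_civita bracket ip = D"
  unfolding levi_civita_def
proof (rule the_equality)
  have torsion: "koszul x y z - koszul y x z = ip (bracket x y) z" for x y z
    unfolding koszul_def bracket_skew[of y x] bracket_skew[of x z] bracket_skew[of z y]
    by (simp add: ip_simps field_simps)
  have "D x y - D y x = bracket x y" for x y
    by (rule nondegenerate) (simp add: ip_simps ip_D torsion)
  moreover have "koszul x y z + koszul x z y = 0" for x y z
    unfolding koszul_def bracket_skew[of y x] bracket_skew[of x z] bracket_skew[of z y]
    by (simp add: ip_simps field_simps)
  then have "ip (D x y) z + ip y (D x z) = 0" for x y z
    unfolding ip_commute[of y] ip_D .
  ultimately show "bilinear D \<and> (\<forall>x y. D x y - D y x = bracket x y) \<and>
      (\<forall>x y z. ip (D x y) z + ip y (D x z) = 0)"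
    by (simp add: bilinear_D)
next
  fix E assume E: "bilinear E \<and> (\<forall>x y. E x y - E y x = bracket x y) \<and>
      (\<forall>x y z. ip (E x y) z + ip y (E x z) = 0)"
  have skew: "ip (E x y) z = - ip (E x z) y" for x y z
    using E[THEN conjunct2, THEN conjunct2, rule_format, of x y z] ip_commute[of y] by simp
  \<comment> \<open>Absence of torsion turns the three brackets in \<open>koszul\<close> into six
    terms; by metric skewness four of them cancel in pairs and the other two add up to
    \<open>2 * ip (E x y) z\<close>.\<close>
  have "ip (E x y) z = koszul x y z" for x y z
    using skew[of x y z] skew[of y z x] skew[of z x y]
    by (simp add: koszul_def E[THEN conjunct2, THEN conjunct1, rule_format, symmetric] ip_simps)
  then show "E = D"
    by (intro ext nondegenerate) (simp add: ip_D)
qed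

section \<open>Curvature, the Schouten-Weyl tensor and its derivative in the frame\<close>

abbreviation "R \<equiv> curvature bracket ip"
abbreviation "Ric \<equiv> ricci bracket ip"
abbreviation "A \<equiv> one_dim_curvature bracket ip"
abbreviation "SW \<equiv> schouten_weyl bracket ip"

lemmas D_simps = bilinear_simps[OF bilinear_D]

lemma curvature_eq: "R x y z = D y (D x z) - D x (D y z) + D (bracket x y) z"
  by (simp add: curvature_def levi_civita_eq Let_def)

lemma linear_curvature:
  "linear (R x y)" "linear (\<lambda>y. R x y z)" "linear (\<lambda>x. R x y z)"
  unfolding curvature_eq
  by (rule linearI; simp add: D_simps bracket_simps algebra_simps)+

lemma ricci_frame: "Ric x y = ip (R x e1 y) e1 + ip (R x e2 y) e2 - ip (R x e3 y) e3"
  by (simp add: ricci_def lin_trace_frame linear_curvature)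

lemma bilinear_ricci: "bilinear Ric"
  unfolding ricci_frame
  by (intro bilinearI' linearI)
    (simp_all add: linear_curvature[THEN linear_add] linear_curvature[THEN linear_scale]
      ip_simps algebra_simps)

lemmas ricci_simps = bilinear_simps[OF bilinear_ricci]

lemma scalar_curvature_frame: "scalar_curvature bracket ip = Ric e1 e1 + Ric e2 e2 - Ric e3 e3"
  by (simp add: scalar_curvature_def metric_trace_frame bilinear_ricci)

text \<open>For n = 3 the factor 1/(n-2) is 1 and 2(n-1) is 4.\<close>

lemma one_dim_curvature_frame: "A x y = Ric x y - scalar_curvature bracket ip * ip x y / 4"
  by (simp add: one_dim_curvature_def dim_frame)

lemma bilinear_one_dim_curvature: "bilinear A"
  unfolding one_dim_curvature_frame
  by (intro bilinearI' linearI)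
    (simp_all add: ricci_simps ip_simps algebra_simps add_divide_distrib)

lemmas A_simps = bilinear_simps[OF bilinear_one_dim_curvature]

lemma schouten_weyl_eq: "SW x y z = A (D y x) z + A x (D y z) - A (D z x) y - A x (D z y)"
  by (simp add: schouten_weyl_def cov_deriv2_def levi_civita_eq Let_def)

lemma schouten_weyl_skew: "SW x z y = - SW x y z"
  by (simp add: schouten_weyl_eq)

lemma schouten_weyl_same [simp]: "SW x y y = 0"
  by (simp add: schouten_weyl_eq)

lemma linear_schouten_weyl:
  "linear (SW x y)" "linear (\<lambda>y. SW x y z)" "linear (\<lambda>x. SW x y z)"
  unfolding schouten_weyl_eq by (rule linearI; simp add: A_simps D_simps algebra_simps)+

lemmas SW_simps =
  linear_schouten_weyl[THEN linear_add] linear_schouten_weyl[THEN linear_scale]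
  linear_schouten_weyl[THEN linear_neg] linear_schouten_weyl[THEN linear_diff]
  linear_schouten_weyl[THEN linear_0]

lemmas schouten_weyl_frame_skew =
  schouten_weyl_skew[of _ e2 e1] schouten_weyl_skew[of _ e3 e1] schouten_weyl_skew[of _ e3 e2]

text \<open>Skewness in the last two indices reduces the 27 components to nine.\<close>

lemma schouten_weyl_eq_0I:
  assumes "\<And>x. x \<in> {e1, e2, e3} \<Longrightarrow> SW x e1 e2 = 0 \<and> SW x e1 e3 = 0 \<and> SW x e2 e3 = 0"
  shows "SW x y z = 0"
proof (rule bilinear_zero_on_frame[of "\<lambda>x y. SW x y z", OF linear_schouten_weyl(3,2)])
  fix x y assume "x \<in> {e1, e2, e3}" "y \<in> {e1, e2, e3}"
  then show "SW x y z = 0"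
    using assms[of x]
    by (intro linear_zero_on_frame[of "SW x y" z] linear_schouten_weyl)
      (auto simp: schouten_weyl_frame_skew)
qed

abbreviation "dSW \<equiv> cov_deriv3 bracket ip SW"

lemma cov_deriv_schouten_weyl_eq:
  "dSW x y z w = - SW (D w x) y z - SW x (D w y) z - SW x y (D w z)"
  by (simp add: cov_deriv3_def levi_civita_eq Let_def)

lemma linear_cov_deriv_schouten_weyl:
  "linear (dSW x y z)" "linear (\<lambda>z. dSW x y z w)" "linear (\<lambda>y. dSW x y z w)" "linear (\<lambda>x. dSW x y z w)"
  unfolding cov_deriv_schouten_weyl_eq
  by (rule linearI; simp add: D_simps SW_simps algebra_simps)+

lemma div1_schouten_weyl_frame:
  "div1 bracket ip SW y z = dSW e1 y z e1 + dSW e2 y z e2 - dSW e3 y z e3"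
  unfolding div1_def
  by (intro metric_trace_frame bilinearI' linear_cov_deriv_schouten_weyl)

lemma div1_schouten_weyl_eq_0I:
  assumes "\<And>y z. y \<in> {e1, e2, e3} \<Longrightarrow> z \<in> {e1, e2, e3} \<Longrightarrow> div1 bracket ip SW y z = 0"
  shows "div1 bracket ip SW y z = 0"
proof (rule bilinear_zero_on_frame[of "div1 bracket ip SW"])
  show "linear (\<lambda>y. div1 bracket ip SW y z)" "linear (\<lambda>z. div1 bracket ip SW y z)" for y z
    unfolding div1_schouten_weyl_frame
    by (rule linearI; simp add: linear_cov_deriv_schouten_weyl[THEN linear_add]
        linear_cov_deriv_schouten_weyl[THEN linear_scale] algebra_simps)+
qed (use assms in auto)

lemma div2_schouten_weyl_eq_0:
  assumes "\<And>x y z. SW x y z = 0"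
  shows "div2 bracket ip SW x z = 0"
  unfolding div2_def
  by (subst metric_trace_frame)
    (intro bilinearI' linear_cov_deriv_schouten_weyl, simp add: cov_deriv_schouten_weyl_eq assms)

lemmas bracket_frame_skew =
  bracket_skew[of e2 e1] bracket_skew[of e3 e1] bracket_skew[of e3 e2]

end

section \<open>Type A2\<close>

locale A2_frame = pseudo_orthonormal_frame bracket ip e1 e2 e3
  for bracket :: "'g::real_vector \<Rightarrow> 'g \<Rightarrow> 'g" and ip e1 e2 e3 +
  fixes l1 l2 :: real
  assumes brackets: "bracket e1 e2 = (1 - l2) *\<^sub>R e3 - e2"
    "bracket e1 e3 = e3 - (1 + l2) *\<^sub>R e2" "bracket e2 e3 = l1 *\<^sub>R e1"
begin

text \<open>\<open>frame_eqI\<close> compares inner products with the frame, and \<open>ip_D\<close>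
  turns these into Koszul expressions in the structure constants.\<close>

lemma D_frame:
  "D e1 e1 = 0" "D e1 e2 = (l1 / 2 - l2) *\<^sub>R e3" "D e1 e3 = (l1 / 2 - l2) *\<^sub>R e2"
  "D e2 e1 = e2 + (l1 / 2 - 1) *\<^sub>R e3" "D e2 e2 = - e1" "D e2 e3 = (l1 / 2 - 1) *\<^sub>R e1"
  "D e3 e1 = (l1 / 2 + 1) *\<^sub>R e2 - e3" "D e3 e2 = - (l1 / 2 + 1) *\<^sub>R e1" "D e3 e3 = - e1"
  by (rule frame_eqI; simp add: ip_D koszul_def brackets bracket_frame_skew alternating ip_simps
      field_simps)+

lemma ricci_values:
  "Ric e1 e1 = - l1\<^sup>2 / 2" "Ric e1 e2 = 0" "Ric e1 e3 = 0"
  "Ric e2 e1 = 0" "Ric e2 e2 = l1 - 2 * l2 - l1 * l2 + l1\<^sup>2 / 2" "Ric e2 e3 = l1 - 2 * l2"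
  "Ric e3 e1 = 0" "Ric e3 e2 = l1 - 2 * l2" "Ric e3 e3 = l1 - 2 * l2 + l1 * l2 - l1\<^sup>2 / 2"
  by (simp_all add: ricci_frame curvature_eq D_frame D_simps brackets bracket_frame_skew alternating
      ip_simps)
    (simp_all add: field_simps power2_eq_square)

lemma schouten_weyl_values:
  "SW e1 e1 e2 = 0" "SW e1 e1 e3 = 0" "SW e1 e2 e3 = l1\<^sup>2 * (l2 - l1)"
  "SW e2 e1 e2 = 4 * l2\<^sup>2 - 2 * l1 * l2 - l1\<^sup>2 / 2"
  "SW e2 e1 e3 = 4 * l2\<^sup>2 - 2 * l1 * l2 - l1\<^sup>2 / 2 + l1\<^sup>2 * (l2 - l1) / 2"
  "SW e2 e2 e3 = 0"
  "SW e3 e1 e2 = 4 * l2\<^sup>2 - 2 * l1 * l2 - l1\<^sup>2 / 2 - l1\<^sup>2 * (l2 - l1) / 2"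
  "SW e3 e1 e3 = 4 * l2\<^sup>2 - 2 * l1 * l2 - l1\<^sup>2 / 2"
  "SW e3 e2 e3 = 0"
  by (simp_all add: schouten_weyl_eq D_frame ricci_simps one_dim_curvature_frame
      scalar_curvature_frame ricci_values ip_simps)
    (simp_all add: field_simps power2_eq_square)

lemmas cov_deriv_values = cov_deriv_schouten_weyl_eq D_frame SW_simps schouten_weyl_frame_skew
  schouten_weyl_values

text \<open>In dimension three, dualising the skew index pair of \<open>SW\<close> gives the
  symmetric, divergence-free Cotton-York tensor. This explains why the components cancel for all
  parameters.\<close>

lemma div1_eq_0: "div1 bracket ip SW y z = 0"
proof (rule div1_schouten_weyl_eq_0I)
  fix y z assume "y \<in> {e1, e2, e3}" "z \<in> {e1, e2, e3}"
  then show "div1 bracket ip SW y z = 0"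
    unfolding div1_schouten_weyl_frame
    by (auto simp: cov_deriv_values) (auto simp: field_simps power2_eq_square)
qed

lemma curl_free_imp_0:
  assumes "curl_free bracket ip SW"
  shows "l1 = 0" "l2 = 0"
proof -
  define curl where "curl x y z w = dSW x y z w - dSW w y z x - dSW x w z y - dSW x y w z" for x y z w
  have curl: "curl x y z w = 0" for x y z w
    using assms unfolding curl_def curl_free_def by (metis diff_diff_eq diff_self)
  \<comment> \<open>This component determines \<open>l2\<close> once \<open>l1 = 0\<close> is known,
    since it then reduces to \<open>- 8 * l2^3\<close>.\<close>
  have "curl e1 e1 e2 e2 = - 8 * l2^3 + 8 * l1 * l2\<^sup>2 - l1\<^sup>2 * l2 - l1^3 / 2"
    by (simp add: curl_def cov_deriv_values) (simp add: field_simps power2_eq_square power3_eq_cube)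
  then have 1: "- 8 * l2^3 + 8 * l1 * l2\<^sup>2 - l1\<^sup>2 * l2 - l1^3 / 2 = 0"
    using curl by simp
  have "4 * curl e2 e1 e3 e1 = l1 * (8 * l2\<^sup>2 + 2 * l1 * l2 - 7 * l1\<^sup>2)"
    by (simp add: curl_def cov_deriv_values) (simp add: field_simps power2_eq_square power3_eq_cube)
  then have 2: "l1 * (8 * l2\<^sup>2 + 2 * l1 * l2 - 7 * l1\<^sup>2) = 0"
    using curl by simp
  \<comment> \<open>The difference of these two components is taken because it splits into powers of
    \<open>l1\<close> and the linear factor \<open>l1 - l2\<close>.\<close>
  have "4 * (curl e2 e1 e2 e1 - curl e2 e1 e3 e1) = 3 * l1^3 * (l1 - l2)"
    by (simp add: curl_def cov_deriv_values) (simp add: field_simps power2_eq_square power3_eq_cube)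
  then have 3: "l1^3 * (l1 - l2) = 0"
    using curl by simp
  then have "l1 = 0 \<or> l1 = l2"
    by simp
  \<comment> \<open>On the branch \<open>l1 = l2\<close> the second polynomial becomes
    \<open>3 * l1^3\<close>.\<close>
  with 2 show "l1 = 0"
    by (auto simp: power2_eq_square)
  with 1 show "l2 = 0"
    by simp
qed

text \<open>At these parameters all of \<open>ricci_values\<close> vanish too, so in dimension three
  the metric is flat.\<close>

lemma schouten_weyl_eq_0:
  assumes "l1 = 0" "l2 = 0"
  shows "SW x y z = 0"
  by (rule schouten_weyl_eq_0I) (use assms in \<open>auto simp: schouten_weyl_values\<close>)

lemma iso_heisenberg:
  assumes "l1 = 0" "l2 = 0"
  shows "isomorphic_to_matrix_algebra bracket heisenberg"
proof -
  \<comment> \<open>The centre is spanned by \<open>e3 - e2 = [e1, e2]\<close>, which is sent to the upper right matrix unit.\<close>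
  define phi :: "'g \<Rightarrow> real^3^3" where
    "phi v = vector [vector [0, ip v e1, - ip v e3], vector [0, 0, ip v e2 - ip v e3], 0]" for v
  have "linear phi"
    by (rule linearI) (simp_all add: phi_def vec_eq_iff forall_3 ip_simps algebra_simps)
  moreover have "bij_betw phi UNIV heisenberg"
  proof (rule bij_betw_byWitness)
    \<comment> \<open>With coordinates x1, x2, x3 of \<open>v\<close>, where x3 =
      \<open>- ip v e3\<close>, the free entries of \<open>phi v\<close> are x1, x3 and x2 +
      x3.\<close>
    let ?inv = "\<lambda>M :: real^3^3. M$1$2 *\<^sub>R e1 + (M$2$3 - M$1$3) *\<^sub>R e2 + M$1$3 *\<^sub>R e3"
    show "\<forall>v\<in>UNIV. ?inv (phi v) = v"
      by (auto intro: frame_eqI simp: phi_def ip_simps)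
    show "\<forall>M\<in>heisenberg. phi (?inv M) = M"
      by (auto simp: phi_def heisenberg_def vec_eq_iff forall_3 ip_simps)
    show "phi ` UNIV \<subseteq> heisenberg"
      by (auto simp: phi_def heisenberg_def forall_3)
  qed simp
  moreover have "phi (bracket x y) = phi x ** phi y - phi y ** phi x" for x y
    using assms
    by (subst bracket_frame_expansion)
      (simp add: phi_def vec_eq_iff forall_3 matrix_matrix_mult_def sum_3 brackets ip_simps algebra_simps)
  ultimately show ?thesis
    unfolding isomorphic_to_matrix_algebra_def by blast
qed

end

section \<open>Type A3\<close>

locale A3_frame = pseudo_orthonormal_frame bracket ip e1 e2 e3
  for bracket :: "'g::real_vector \<Rightarrow> 'g \<Rightarrow> 'g" and ip e1 e2 e3 +
  fixes l :: real
  assumes brackets: "bracket e1 e2 = e1 - l *\<^sub>R e3"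
    "bracket e1 e3 = - (l *\<^sub>R e2) - e1" "bracket e2 e3 = l *\<^sub>R e1 + e2 + e3"
begin

lemma D_frame:
  "D e1 e1 = - e2 - e3" "D e1 e2 = e1 - (l / 2) *\<^sub>R e3" "D e1 e3 = - e1 - (l / 2) *\<^sub>R e2"
  "D e2 e1 = (l / 2) *\<^sub>R e3" "D e2 e2 = e3" "D e2 e3 = (l / 2) *\<^sub>R e1 + e2"
  "D e3 e1 = (l / 2) *\<^sub>R e2" "D e3 e2 = - (l / 2) *\<^sub>R e1 - e3" "D e3 e3 = - e2"
  by (rule frame_eqI; simp add: ip_D koszul_def brackets bracket_frame_skew alternating ip_simps
      field_simps)+

lemma ricci_values:
  "Ric e1 e1 = - l\<^sup>2 / 2" "Ric e1 e2 = - l" "Ric e1 e3 = l"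
  "Ric e2 e1 = - l" "Ric e2 e2 = - 2 - l\<^sup>2 / 2" "Ric e2 e3 = 2"
  "Ric e3 e1 = l" "Ric e3 e2 = 2" "Ric e3 e3 = - 2 + l\<^sup>2 / 2"
  by (simp_all add: ricci_frame curvature_eq D_frame D_simps brackets bracket_frame_skew alternating
      ip_simps)
    (simp_all add: field_simps power2_eq_square)

text \<open>Every component is a multiple of \<open>l\<close>, whereas \<open>Ric\<close> is nonzero
  at \<open>l = 0\<close>: that metric is conformally flat but not flat.\<close>

lemma schouten_weyl_values:
  "SW e1 e1 e2 = - 3 * l\<^sup>2 / 2" "SW e1 e1 e3 = 3 * l\<^sup>2 / 2" "SW e1 e2 e3 = 0"
  "SW e2 e1 e2 = - 6 * l" "SW e2 e1 e3 = 6 * l" "SW e2 e2 e3 = - 3 * l\<^sup>2 / 2"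
  "SW e3 e1 e2 = 6 * l" "SW e3 e1 e3 = - 6 * l" "SW e3 e2 e3 = 3 * l\<^sup>2 / 2"
  by (simp_all add: schouten_weyl_eq D_frame ricci_simps one_dim_curvature_frame
      scalar_curvature_frame ricci_values ip_simps)
    (simp_all add: field_simps power2_eq_square)

lemmas cov_deriv_values = cov_deriv_schouten_weyl_eq D_frame SW_simps schouten_weyl_frame_skew
  schouten_weyl_values

lemma div1_eq_0: "div1 bracket ip SW y z = 0"
proof (rule div1_schouten_weyl_eq_0I)
  fix y z assume "y \<in> {e1, e2, e3}" "z \<in> {e1, e2, e3}"
  then show "div1 bracket ip SW y z = 0"
    unfolding div1_schouten_weyl_frame
    by (auto simp: cov_deriv_values)
qed

lemma curl_free_imp_0:
  assumes "curl_free bracket ip SW"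
  shows "l = 0"
proof -
  \<comment> \<open>Equal first and last indices make one term cancel against the left-hand side.
    The cubic parts of the other two terms cancel each other, leaving
    \<open>12 * l = 0\<close>.\<close>
  have "dSW e2 e1 e3 e2 = dSW e2 e1 e3 e2 + dSW e2 e2 e3 e1 + dSW e2 e1 e2 e3"
    using assms unfolding curl_free_def by blast
  then show ?thesis
    by (simp add: cov_deriv_values)
qed

lemma schouten_weyl_eq_0:
  assumes "l = 0"
  shows "SW x y z = 0"
  by (rule schouten_weyl_eq_0I) (use assms in \<open>auto simp: schouten_weyl_values\<close>)

lemma iso_e11:
  assumes "l = 0"
  shows "isomorphic_to_matrix_algebra bracket e11"
proof -
  \<comment> \<open>\<open>e2\<close> is sent to the infinitesimal boost; \<open>e2 + e3\<close> and \<open>e1\<close> are eigenvectors of \<open>ad e2\<close> for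
    the eigenvalues \<open>1\<close> and \<open>-1\<close>, hence are sent to the translations along \<open>(1,1)\<close> and \<open>(1,-1)\<close>.\<close>
  define phi :: "'g \<Rightarrow> real^3^3" where
    "phi v = vector [vector [0, ip v e2 + ip v e3, ip v e1 - ip v e3],
      vector [ip v e2 + ip v e3, 0, - ip v e1 - ip v e3], 0]" for v
  have "linear phi"
    by (rule linearI) (simp_all add: phi_def vec_eq_iff forall_3 ip_simps algebra_simps)
  moreover have "bij_betw phi UNIV e11"
  proof (rule bij_betw_byWitness)
    \<comment> \<open>In coordinates x1, x2, x3 of \<open>v\<close> the entries (1,2), (1,3), (2,3)
      of \<open>phi v\<close> are x2 - x3, x1 + x3 and x3 - x1; half the difference and half the sum
      of the last two recover x1 and x3.\<close>
    let ?inv = "\<lambda>M :: real^3^3. ((M$1$3 - M$2$3) / 2) *\<^sub>R e1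
      + (M$1$2 + (M$1$3 + M$2$3) / 2) *\<^sub>R e2 + ((M$1$3 + M$2$3) / 2) *\<^sub>R e3"
    show "\<forall>v\<in>UNIV. ?inv (phi v) = v"
      by (auto intro: frame_eqI simp: phi_def ip_simps)
    show "\<forall>M\<in>e11. phi (?inv M) = M"
      by (auto simp: phi_def e11_eq vec_eq_iff forall_3 ip_simps field_simps)
    show "phi ` UNIV \<subseteq> e11"
      by (auto simp: phi_def e11_eq forall_3)
  qed simp
  moreover have "phi (bracket x y) = phi x ** phi y - phi y ** phi x" for x y
    using assms
    by (subst bracket_frame_expansion)
      (simp add: phi_def vec_eq_iff forall_3 matrix_matrix_mult_def sum_3 brackets ip_simps algebra_simps)
  ultimately show ?thesis
    unfolding isomorphic_to_matrix_algebra_def by blast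
qed

end

section \<open>Passage from the two types to their adapted frames\<close>

theorem theorem4p1:
  fixes bracket :: "'g::real_vector \<Rightarrow> 'g \<Rightarrow> 'g"
    and ip :: "'g \<Rightarrow> 'g \<Rightarrow> real"
    and l1 l2 l :: real
  defines "SW \<equiv> schouten_weyl bracket ip"
  assumes "lie_algebra bracket"
    and "dim (UNIV :: 'g set) = 3"
    and "unimodular bracket"
    and "lorentzian_inner_product ip"
    and "type_A2 bracket ip l1 l2 \<or> type_A3 bracket ip l"
  shows "(\<forall>y z. div1 bracket ip SW y z = 0) \<and>
    (curl_free bracket ip SW \<longrightarrow>
      almost_harmonic bracket ip SW \<and>
      (\<forall>x y z. SW x y z = 0) \<and>
      (\<forall>x z. div2 bracket ip SW x z = 0) \<and>
      ((type_A2 bracket ip l1 l2 \<and> l1 = 0 \<and> l2 = 0 \<and>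
          isomorphic_to_matrix_algebra bracket heisenberg) \<or>
       (type_A3 bracket ip l \<and> l = 0 \<and>
          isomorphic_to_matrix_algebra bracket e11)))"
proof -
  have bilinear: "bilinear ip" and commute: "ip x y = ip y x" for x y
    using assms(5) by (auto simp: lorentzian_inner_product_def)
  from assms(6) show ?thesis
  proof
    assume A2: "type_A2 bracket ip l1 l2"
    then obtain e1 e2 e3 where e: "pseudo_orthonormal_basis ip e1 e2 e3"
        "bracket e1 e2 = (1 - l2) *\<^sub>R e3 - e2"
        "bracket e1 e3 = e3 - (1 + l2) *\<^sub>R e2"
        "bracket e2 e3 = l1 *\<^sub>R e1"
      unfolding type_A2_def by blast
    interpret A2_frame bracket ip e1 e2 e3 l1 l2
      by (intro A2_frame.intro pseudo_orthonormal_frame.intro pseudo_orthonormal_frame_axioms.intro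
          A2_frame_axioms.intro assms bilinear commute e)
    show ?thesis
      unfolding SW_def almost_harmonic_def
      using A2 div1_eq_0 curl_free_imp_0 iso_heisenberg schouten_weyl_eq_0 div2_schouten_weyl_eq_0
      by blast
  next
    assume A3: "type_A3 bracket ip l"
    then obtain e1 e2 e3 where e: "pseudo_orthonormal_basis ip e1 e2 e3"
        "bracket e1 e2 = e1 - l *\<^sub>R e3"
        "bracket e1 e3 = - (l *\<^sub>R e2) - e1"
        "bracket e2 e3 = l *\<^sub>R e1 + e2 + e3"
      unfolding type_A3_def by blast
    interpret A3_frame bracket ip e1 e2 e3 l
      by (intro A3_frame.intro pseudo_orthonormal_frame.intro pseudo_orthonormal_frame_axioms.intro
          A3_frame_axioms.intro assms bilinear commute e)
    show ?thesis
      unfolding SW_def almost_harmonic_def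
      using A3 div1_eq_0 curl_free_imp_0 iso_e11 schouten_weyl_eq_0 div2_schouten_weyl_eq_0
      by blast
  qed
qed

end
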